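(* Let $m$ and $n$ be even integers and let $d$ be an integer. Then: (a) if $m\geq 2$ and $n\geq 4$, then $\tau_{d}(P_m\square C_n)=3d$ whenever $1\leq d\leq n$; (b) if $m\geq 4$ and $n\geq 4$, then $\tau_{d}(P_m\square C_n)=4d-n$ whenever $n+1\leq d\leq \frac{mn}{2}$.
   Context: All graphs are simple, finite and undirected. A matching of a graph $G$ is a set of edges no two of which share an endpoint; a maximum matching is a matching of largest cardinality, and this cardinality is denoted $\nu(G)$. For an integer $d$ with $1\leq d\leq \nu(G)$, a $d$-transversal set of $G$ is a set $T\subseteq E(G)$ such that $|T\cap M|\geq d$ for every maximum matching $M$ of $G$; $\tau_d(G)$ denotes the minimum cardinality of a $d$-transversal set of $G$. $P_m$ is the path with $m$ vertices, $C_n$ is the cycle with $n$ vertices ($n\ge 3$). The Cartesian product $G\square H$ has vertex set $V(G)\times V(H)$, with $(g_1,h_1)$ and $(g_2,h_2)$ adjacent iff either $g_1=g_2$ and $h_1h_2\in E(H)$, or $g_1g_2\in E(G)$ and $h_1=h_2$. *)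

theory Defs
  imports Main
begin

text \<open>
  A finite simple undirected graph is given by its vertex set and its edge set,
  an edge being the two-element set of its endpoints.
\<close>

record 'a ugraph =
  verts :: "'a set"
  edges :: "'a set set"

definition simple_graph :: "'a ugraph \<Rightarrow> bool" where
  "simple_graph G \<longleftrightarrow> finite (verts G) \<and> (\<forall>e\<in>edges G. e \<subseteq> verts G \<and> card e = 2)"

definition matching :: "'a ugraph \<Rightarrow> 'a set set \<Rightarrow> bool" where
  "matching G M \<longleftrightarrow> M \<subseteq> edges G \<and> pairwise disjnt M"

definition maximum_matching :: "'a ugraph \<Rightarrow> 'a set set \<Rightarrow> bool" where
  "maximum_matching G M \<longleftrightarrow> matching G M \<and> (\<forall>M'. matching G M' \<longrightarrow> card M' \<le> card M)"

definition matching_number :: "'a ugraph \<Rightarrow> nat" (\<open>\<nu>\<close>) where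
  "\<nu> G = Max (card ` {M. matching G M})"

definition transversal_set :: "nat \<Rightarrow> 'a ugraph \<Rightarrow> 'a set set \<Rightarrow> bool" where
  "transversal_set d G T \<longleftrightarrow>
     1 \<le> d \<and> d \<le> \<nu> G \<and> T \<subseteq> edges G \<and>
     (\<forall>M. maximum_matching G M \<longrightarrow> d \<le> card (T \<inter> M))"

text \<open>
  The minimum is meaningful exactly when \<open>1 \<le> d \<le> \<nu> G\<close>; see
  \<open>transversal_number_attained\<close> below. Outside this range it is unspecified.
\<close>

definition transversal_number :: "nat \<Rightarrow> 'a ugraph \<Rightarrow> nat" (\<open>\<tau>\<close>) where
  "\<tau> d G = (LEAST k. \<exists>T. transversal_set d G T \<and> card T = k)"

definition path_graph :: "nat \<Rightarrow> nat ugraph" where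
  "path_graph m = \<lparr>verts = {..<m}, edges = {{i, Suc i} | i. Suc i < m}\<rparr>"

text \<open>Only for \<open>n \<ge> 3\<close> is this the cycle on \<open>n\<close> vertices.\<close>

definition cycle_graph :: "nat \<Rightarrow> nat ugraph" where
  "cycle_graph n = \<lparr>verts = {..<n}, edges = {{i, Suc i mod n} | i. i < n}\<rparr>"

definition cartesian_product :: "'a ugraph \<Rightarrow> 'b ugraph \<Rightarrow> ('a \<times> 'b) ugraph"
    (infixr \<open>\<box>\<close> 70) where
  "G \<box> H =
     \<lparr>verts = verts G \<times> verts H,
      edges = {{(g1, h1), (g2, h2)} | g1 h1 g2 h2.
        (g1, h1) \<in> verts G \<times> verts H \<and> (g2, h2) \<in> verts G \<times> verts H \<and>
        (g1 = g2 \<and> {h1, h2} \<in> edges H \<or> {g1, g2} \<in> edges G \<and> h1 = h2)}\<rparr>"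

lemma simple_graph_finite_edges: "simple_graph G \<Longrightarrow> finite (edges G)"
  unfolding simple_graph_def by (meson Pow_iff finite_Pow_iff finite_subset subsetI)

lemma simple_graph_path_graph: "simple_graph (path_graph m)"
  by (auto simp: simple_graph_def path_graph_def)

lemma simple_graph_cycle_graph:
  assumes "n \<ge> 3" shows "simple_graph (cycle_graph n)"
proof -
  have "i \<noteq> Suc i mod n" if "i < n" for i
    using that assms by (cases "Suc i = n") auto
  then show ?thesis
    using assms by (auto simp: simple_graph_def cycle_graph_def)
qed

lemma simple_graph_cartesian_product:
  assumes "simple_graph G" "simple_graph H" shows "simple_graph (G \<box> H)"
proof -
  have "{x} \<notin> edges G" "{y} \<notin> edges H" for x y
    using assms by (auto simp: simple_graph_def)
  then show ?thesis
    using assms by (auto simp: simple_graph_def cartesian_product_def card_insert_if)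
qed

lemma maximum_matching_iff:
  assumes "simple_graph G"
  shows "maximum_matching G M \<longleftrightarrow> matching G M \<and> card M = \<nu> G"
proof -
  have fin: "finite {M. matching G M}"
    by (rule finite_subset[of _ "Pow (edges G)"])
      (use simple_graph_finite_edges[OF assms] in \<open>auto simp: matching_def\<close>)
  have ne: "matching G {}"
    by (simp add: matching_def)
  have ub: "card M \<le> \<nu> G" if "matching G M" for M
    unfolding matching_number_def using fin that by (intro Max_ge) auto
  have "\<nu> G \<in> card ` {M. matching G M}"
    unfolding matching_number_def using fin ne by (intro Max_in) auto
  then obtain M0 where "matching G M0" "card M0 = \<nu> G" by auto
  then show ?thesis
    using ub unfolding maximum_matching_def by (metis le_antisym)
qed

lemma transversal_number_attained:
  assumes "simple_graph G" "1 \<le> d" "d \<le> \<nu> G"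
  shows "\<exists>T. transversal_set d G T \<and> card T = \<tau> d G"
    and "transversal_set d G T \<Longrightarrow> \<tau> d G \<le> card T"
proof -
  have "transversal_set d G (edges G)"
    using assms by (auto simp: transversal_set_def maximum_matching_iff matching_def Int_absorb1)
  then show "\<exists>T. transversal_set d G T \<and> card T = \<tau> d G"
    unfolding transversal_number_def
    by (intro LeastI[of "\<lambda>k. \<exists>T. transversal_set d G T \<and> card T = k"]) blast
  show "\<tau> d G \<le> card T" if "transversal_set d G T"
    unfolding transversal_number_def using that by (intro Least_le) blast
qed

end

theory Submission
  imports Defs
begin

text \<open>
  Since \<open>m\<close> and \<open>n\<close> are even, the cylinder \<open>path_graph m \<box> cycle_graph n\<close> is
  bipartite, coloured by the parity of the coordinate sum, and has perfect matchings, so its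
  maximum matchings are exactly the perfect ones and \<open>\<nu> = m * n div 2\<close>.

  Upper bound. A perfect matching has exactly one edge at every vertex, and an edge has only one
  end of each colour. Hence all edges at \<open>d\<close> vertices of one colour form a \<open>d\<close>-transversal set
  (\<open>transversal_set_star\<close>). Vertices in the two outer rows have degree 3, the others have degree 4,
  and each colour class has \<open>n\<close> vertices in the outer rows. Taking those first costs \<open>3 * d\<close> edges if
  \<open>d \<le> n\<close>, and \<open>3 * n + 4 * (d - n) = 4 * d - n\<close> edges otherwise.

  Lower bound. A \<open>d\<close>-transversal set \<open>T\<close> meets every perfect matching in at least \<open>d\<close> edges, so well
  chosen perfect matchings that overlap little force \<open>T\<close> to be large. Take the two alternating
  matchings of the rows, \<open>A\<close> and \<open>B\<close>; the rungs \<open>C\<close> between rows \<open>2 * i\<close> and \<open>2 * i + 1\<close>; and \<open>D\<close>, the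
  rungs between rows \<open>2 * i + 1\<close> and \<open>2 * i + 2\<close>, completed by the edges of \<open>A\<close> in the two outer rows,
  which these rungs miss. The first three are disjoint, which gives \<open>3 * d \<le> card T\<close>. The only overlap
  among all four is the \<open>n\<close> edges of \<open>A \<inter> D\<close>, which gives \<open>4 * d \<le> card T + n\<close>. For each \<open>d\<close> one of
  these bounds agrees with the upper bound.
\<close>

section \<open>Perfect matchings given by involutions\<close>

text \<open>
  A perfect matching is encoded by the map sending each vertex to its partner. Intersections of two
  perfect matchings can then be read off vertex by vertex, from where the two maps agree.
\<close>

definition partner_map :: "'a ugraph \<Rightarrow> ('a \<Rightarrow> 'a) \<Rightarrow> bool" where
  "partner_map G f \<longleftrightarrow> (\<forall>v\<in>verts G. f v \<in> verts G \<and> f (f v) = v \<and> {v, f v} \<in> edges G)"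

definition partner_edges :: "'a ugraph \<Rightarrow> ('a \<Rightarrow> 'a) \<Rightarrow> 'a set set" where
  "partner_edges G f = (\<lambda>v. {v, f v}) ` verts G"

lemma card_Union_matching:
  assumes "simple_graph G" "matching G M"
  shows "card (\<Union>M) = 2 * card M"
proof -
  have 2: "card e = 2" if "e \<in> M" for e
    using assms that by (auto simp: simple_graph_def matching_def)
  then have "finite e" if "e \<in> M" for e
    using that by (metis card.infinite zero_neq_numeral)
  then have "card (\<Union>M) = sum card M"
    using assms(2) by (intro card_Union_disjoint) (auto simp: matching_def)
  with 2 show ?thesis by simp
qed

lemma Union_matching_subset:
  assumes "simple_graph G" "matching G M"
  shows "\<Union>M \<subseteq> verts G"
  using assms by (auto simp: simple_graph_def matching_def)

lemma partner_edge_at: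
  assumes "partner_map G f" "e \<in> partner_edges G f" "v \<in> e"
  shows "v \<in> verts G" "e = {v, f v}"
  using assms by (auto simp: partner_edges_def partner_map_def)

lemma matching_partner_edges:
  assumes "partner_map G f"
  shows "matching G (partner_edges G f)"
proof -
  have "d = e" if "d \<in> partner_edges G f" "e \<in> partner_edges G f" "v \<in> d" "v \<in> e" for d e v
    using partner_edge_at[OF assms] that by metis
  then have "pairwise disjnt (partner_edges G f)"
    unfolding pairwise_def disjnt_iff by blast
  with assms show ?thesis
    by (auto simp: matching_def partner_edges_def partner_map_def)
qed

text \<open>
  No matching covers more than all vertices, so one that covers them all is maximum, and its size
  pins down \<open>\<nu>\<close>.
\<close>

lemma maximum_matching_partner_edges:
  assumes "simple_graph G" "partner_map G f"
  shows "maximum_matching G (partner_edges G f)" and "2 * \<nu> G = card (verts G)"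
proof -
  let ?M = "partner_edges G f"
  have M: "matching G ?M" using assms(2) by (rule matching_partner_edges)
  have "\<Union>?M = verts G"
    using assms(2) by (auto simp: partner_edges_def partner_map_def)
  then have cM: "2 * card ?M = card (verts G)"
    using card_Union_matching[OF assms(1) M] by simp
  have "card N \<le> card ?M" if "matching G N" for N
    using card_mono[OF _ Union_matching_subset[OF assms(1) that]] card_Union_matching[OF assms(1) that]
      cM assms(1) by (simp add: simple_graph_def)
  with M show max: "maximum_matching G ?M"
    by (auto simp: maximum_matching_def)
  with cM show "2 * \<nu> G = card (verts G)"
    using maximum_matching_iff[OF assms(1)] by simp
qed

lemma Union_maximum_matching:
  assumes "simple_graph G" "2 * \<nu> G = card (verts G)" "maximum_matching G M"
  shows "\<Union>M = verts G"
proof (rule card_subset_eq)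
  have M: "matching G M" "card M = \<nu> G"
    using assms maximum_matching_iff by blast+
  show "finite (verts G)" using assms(1) by (simp add: simple_graph_def)
  show "\<Union>M \<subseteq> verts G" using assms(1) M(1) by (rule Union_matching_subset)
  show "card (\<Union>M) = card (verts G)"
    using card_Union_matching[OF assms(1) M(1)] M(2) assms(2) by simp
qed

text \<open>
  The common edges form a matching that covers exactly the vertices whose two partners coincide, and
  each edge covers two of them.
\<close>

lemma card_partner_edges_Int:
  assumes "simple_graph G" "partner_map G f" "partner_map G g"
  shows "2 * card (partner_edges G f \<inter> partner_edges G g) = card {v \<in> verts G. f v = g v}"
proof -
  let ?I = "partner_edges G f \<inter> partner_edges G g"
  have I: "matching G ?I"
    using matching_partner_edges[OF assms(2)]
    by (auto simp: matching_def intro: pairwise_subset)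
  have "\<Union>?I = {v \<in> verts G. f v = g v}"
  proof (intro equalityI subsetI)
    fix v assume "v \<in> \<Union>?I"
    then obtain e where "e \<in> partner_edges G f" "e \<in> partner_edges G g" "v \<in> e" by blast
    then have "v \<in> verts G" "{v, f v} = {v, g v}"
      using partner_edge_at[OF assms(2), of e v] partner_edge_at[OF assms(3), of e v] by simp_all
    then show "v \<in> {v \<in> verts G. f v = g v}"
      by (auto simp: doubleton_eq_iff)
  next
    fix v assume "v \<in> {v \<in> verts G. f v = g v}"
    then have "{v, f v} \<in> ?I" by (auto simp: partner_edges_def)
    then show "v \<in> \<Union>?I" by blast
  qed
  with card_Union_matching[OF assms(1) I] show ?thesis by simp
qed

lemma partner_edges_disjoint:
  assumes "simple_graph G" "partner_map G f" "partner_map G g" "\<And>v. v \<in> verts G \<Longrightarrow> f v \<noteq> g v"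
  shows "partner_edges G f \<inter> partner_edges G g = {}"
proof -
  have "{v \<in> verts G. f v = g v} = {}" using assms(4) by auto
  with card_partner_edges_Int[OF assms(1-3)]
  have "card (partner_edges G f \<inter> partner_edges G g) = 0" by simp
  moreover have "finite (partner_edges G f)"
    using assms(1) by (simp add: partner_edges_def simple_graph_def)
  ultimately show ?thesis by simp
qed

section \<open>Two bounds for transversal sets\<close>

lemma card_Int_Un_disjoint:
  assumes "finite T" "A \<inter> B = {}"
  shows "card (T \<inter> (A \<union> B)) = card (T \<inter> A) + card (T \<inter> B)"
  unfolding Int_Un_distrib by (rule card_Un_disjoint) (use assms in auto)

lemma transversal_card_ge_disjoint_matchings:
  assumes G: "simple_graph G" and T: "transversal_set d G T"
    and max: "maximum_matching G A" "maximum_matching G B" "maximum_matching G C"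
    and disj: "A \<inter> B = {}" "A \<inter> C = {}" "B \<inter> C = {}"
  shows "3 * d \<le> card T"
proof -
  have fin: "finite T"
    using T simple_graph_finite_edges[OF G] by (auto simp: transversal_set_def intro: finite_subset)
  have ge: "d \<le> card (T \<inter> M)" if "maximum_matching G M" for M
    using T that by (simp add: transversal_set_def)
  have "3 * d \<le> card (T \<inter> A) + card (T \<inter> B) + card (T \<inter> C)"
    using max[THEN ge] by linarith
  also have "\<dots> = card (T \<inter> (A \<union> B \<union> C))"
    using fin disj by (simp add: card_Int_Un_disjoint Int_Un_distrib2)
  also have "\<dots> \<le> card T" using fin by (intro card_mono) auto
  finally show ?thesis .
qed

text \<open>
  Counting \<open>T\<close> along the four matchings counts each edge at most once, except that the edges in
  \<open>A \<inter> D\<close> are counted twice.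
\<close>

lemma transversal_card_ge_overlapping_matchings:
  assumes G: "simple_graph G" and T: "transversal_set d G T"
    and max: "maximum_matching G A" "maximum_matching G B" "maximum_matching G C" "maximum_matching G D"
    and disj: "A \<inter> B = {}" "A \<inter> C = {}" "B \<inter> C = {}" "D \<inter> B = {}" "D \<inter> C = {}"
  shows "4 * d \<le> card T + card (A \<inter> D)"
proof -
  have fin: "finite T" "finite A"
    using T max(1) simple_graph_finite_edges[OF G]
    by (auto simp: transversal_set_def maximum_matching_def matching_def intro: finite_subset)
  have ge: "d \<le> card (T \<inter> M)" if "maximum_matching G M" for M
    using T that by (simp add: transversal_set_def)
  have "4 * d \<le> card (T \<inter> A) + card (T \<inter> D) + card (T \<inter> B) + card (T \<inter> C)"
    using max[THEN ge] by linarith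
  also have "card (T \<inter> A) + card (T \<inter> D) = card (T \<inter> (A \<union> D)) + card (T \<inter> A \<inter> D)"
    using fin card_Un_Int[of "T \<inter> A" "T \<inter> D"] by (simp add: Int_Un_distrib Int_assoc Int_left_commute)
  also have "\<dots> + card (T \<inter> B) + card (T \<inter> C) = card (T \<inter> (A \<union> D \<union> B \<union> C)) + card (T \<inter> A \<inter> D)"
    using fin disj by (simp add: card_Int_Un_disjoint[of T "A \<union> D \<union> B"] card_Int_Un_disjoint[of T "A \<union> D"] Int_Un_distrib2)
  also have "\<dots> \<le> card T + card (A \<inter> D)"
    using fin by (intro add_mono card_mono) auto
  finally show ?thesis .
qed

text \<open>
  Every maximum matching is perfect, so it contains an edge at each \<open>w \<in> W\<close>; by independence of \<open>W\<close>
  these edges are distinct for distinct \<open>w\<close>.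
\<close>

lemma transversal_set_star:
  assumes G: "simple_graph G" and perfect: "2 * \<nu> G = card (verts G)"
    and W: "W \<subseteq> verts G" "1 \<le> card W" "card W \<le> \<nu> G"
    and indep: "\<And>e u v. e \<in> edges G \<Longrightarrow> u \<in> e \<Longrightarrow> v \<in> e \<Longrightarrow> u \<in> W \<Longrightarrow> v \<in> W \<Longrightarrow> u = v"
  shows "transversal_set (card W) G {e \<in> edges G. e \<inter> W \<noteq> {}}"
  unfolding transversal_set_def
proof (intro conjI allI impI)
  fix M assume max: "maximum_matching G M"
  then have M: "M \<subseteq> edges G" by (simp add: maximum_matching_def matching_def)
  have "\<exists>e\<in>M. w \<in> e" if "w \<in> W" for w
    using Union_maximum_matching[OF G perfect max] W(1) that by blast
  then obtain h where h: "h w \<in> M" "w \<in> h w" if "w \<in> W" for w by metis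
  show "card W \<le> card ({e \<in> edges G. e \<inter> W \<noteq> {}} \<inter> M)"
  proof (rule card_inj_on_le)
    show "inj_on h W" using h M indep by (metis inj_onI subsetD)
    show "h ` W \<subseteq> {e \<in> edges G. e \<inter> W \<noteq> {}} \<inter> M" using h M by blast
    show "finite ({e \<in> edges G. e \<inter> W \<noteq> {}} \<inter> M)" using simple_graph_finite_edges[OF G] by simp
  qed
qed (use W in auto)

lemma card_half_involution:
  assumes "finite S" "\<And>v. v \<in> S \<Longrightarrow> f v \<in> S \<and> f (f v) = v \<and> (P (f v) \<longleftrightarrow> \<not> P v)"
  shows "2 * card {v \<in> S. P v} = card S"
proof -
  have "bij_betw f {v \<in> S. P v} {v \<in> S. \<not> P v}"
    by (rule bij_betw_byWitness[where f' = f]) (use assms(2) in auto)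
  then have "card {v \<in> S. P v} = card {v \<in> S. \<not> P v}" by (rule bij_betw_same_card)
  moreover have "card S = card {v \<in> S. P v} + card {v \<in> S. \<not> P v}"
    using assms(1) by (subst card_Un_disjoint[symmetric]) (auto intro: arg_cong[where f = card])
  ultimately show ?thesis by simp
qed

section \<open>Four perfect matchings of the cylinder\<close>

text \<open>
  The two perfect matchings of an even cycle on \<open>{..<n}\<close>: one has the edges \<open>{2 * k, 2 * k + 1}\<close>, the
  other the edges \<open>{2 * k + 1, 2 * k + 2}\<close>, where \<open>n - 1\<close> is joined to \<open>0\<close>. The same maps
  describe the path: away from its two ends the wrap-around does not occur.
\<close>

definition even_partner :: "nat \<Rightarrow> nat" where
  "even_partner j = (if even j then Suc j else j - 1)"

definition odd_partner :: "nat \<Rightarrow> nat \<Rightarrow> nat" where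
  "odd_partner n j = (if odd j then Suc j mod n else if j = 0 then n - 1 else j - 1)"

lemma even_partner:
  assumes "even n" "j < n"
  shows "even_partner j < n" "even_partner (even_partner j) = j" "even (even_partner j) \<longleftrightarrow> odd j"
  using assms by (auto simp: even_partner_def elim!: oddE evenE)

lemma odd_partner:
  assumes "even n" "j < n"
  shows "odd_partner n j < n" "odd_partner n (odd_partner n j) = j" "even (odd_partner n j) \<longleftrightarrow> odd j"
proof -
  consider "j = 0" | "Suc j = n" | "0 < j" "Suc j < n" using assms(2) by linarith
  then have "odd_partner n j < n \<and> odd_partner n (odd_partner n j) = j \<and> (even (odd_partner n j) \<longleftrightarrow> odd j)"
    by cases (use assms in \<open>auto simp: odd_partner_def odd_pos\<close>)
  then show "odd_partner n j < n" "odd_partner n (odd_partner n j) = j" "even (odd_partner n j) \<longleftrightarrow> odd j"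
    by auto
qed

lemma even_partner_neq_odd_partner:
  assumes "2 < n" "j < n"
  shows "even_partner j \<noteq> odd_partner n j"
proof (cases "odd j")
  case True
  with assms show ?thesis
    by (cases "Suc j = n") (auto simp: even_partner_def odd_partner_def)
next
  case False
  with assms show ?thesis by (auto simp: even_partner_def odd_partner_def)
qed

lemma cycle_edge_iff:
  assumes "even n" "2 \<le> n" "j < n" "k < n"
  shows "{j, k} \<in> edges (cycle_graph n) \<longleftrightarrow> k = even_partner j \<or> k = odd_partner n j"
proof -
  have "{j, k} \<in> edges (cycle_graph n) \<longleftrightarrow> k = Suc j mod n \<or> j = Suc k mod n"
    using assms by (auto simp: cycle_graph_def doubleton_eq_iff)
  also have "j = Suc k mod n \<longleftrightarrow> k = (if j = 0 then n - 1 else j - 1)"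
    using assms by (cases "Suc k = n") auto
  also have "k = Suc j mod n \<or> k = (if j = 0 then n - 1 else j - 1) \<longleftrightarrow>
      k = even_partner j \<or> k = odd_partner n j"
    using assms by (cases "Suc j = n") (auto simp: even_partner_def odd_partner_def)
  finally show ?thesis .
qed

lemma path_edge_iff:
  assumes "even m" "i < m" "k < m"
  shows "{i, k} \<in> edges (path_graph m) \<longleftrightarrow>
    k = even_partner i \<or> i \<noteq> 0 \<and> i \<noteq> m - 1 \<and> k = odd_partner m i"
proof -
  have "{i, k} \<in> edges (path_graph m) \<longleftrightarrow> k = Suc i \<or> i = Suc k"
    using assms by (auto simp: path_graph_def doubleton_eq_iff)
  also have "\<dots> \<longleftrightarrow> k = even_partner i \<or> i \<noteq> 0 \<and> i \<noteq> m - 1 \<and> k = odd_partner m i"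
    using assms by (cases "Suc i = m") (auto simp: even_partner_def odd_partner_def)
  finally show ?thesis .
qed

abbreviation cylinder :: "nat \<Rightarrow> nat \<Rightarrow> (nat \<times> nat) ugraph" where
  "cylinder m n \<equiv> path_graph m \<box> cycle_graph n"

abbreviation outer :: "nat \<Rightarrow> nat \<Rightarrow> bool" where
  "outer m i \<equiv> i = 0 \<or> i = m - 1"

text \<open>
  The partner maps of the four matchings called \<open>A\<close>, \<open>B\<close>, \<open>C\<close> and \<open>D\<close> above. At an outer vertex
  \<open>rung_odd\<close> falls back to the partner in the row, because no rung between rows \<open>2 * i + 1\<close> and
  \<open>2 * i + 2\<close> ends there.
\<close>

definition row_even :: "nat \<times> nat \<Rightarrow> nat \<times> nat" where
  "row_even = (\<lambda>(i, j). (i, even_partner j))"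

definition row_odd :: "nat \<Rightarrow> nat \<times> nat \<Rightarrow> nat \<times> nat" where
  "row_odd n = (\<lambda>(i, j). (i, odd_partner n j))"

definition rung_even :: "nat \<times> nat \<Rightarrow> nat \<times> nat" where
  "rung_even = (\<lambda>(i, j). (even_partner i, j))"

definition rung_odd :: "nat \<Rightarrow> nat \<times> nat \<Rightarrow> nat \<times> nat" where
  "rung_odd m = (\<lambda>(i, j). if outer m i then (i, even_partner j) else (odd_partner m i, j))"

lemma cylinder_edge_iff:
  "{(i, j), (k, l)} \<in> edges (cylinder m n) \<longleftrightarrow>
     i < m \<and> j < n \<and> k < m \<and> l < n \<and>
     (i = k \<and> {j, l} \<in> edges (cycle_graph n) \<or> {i, k} \<in> edges (path_graph m) \<and> j = l)"
proof -
  have [simp]: "verts (path_graph m) = {..<m}" "verts (cycle_graph n) = {..<n}"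
    by (simp_all add: path_graph_def cycle_graph_def)
  show ?thesis
    unfolding cartesian_product_def
    by (auto simp: doubleton_eq_iff insert_commute[of k i] insert_commute[of l j])
qed

lemma verts_cylinder: "verts (cylinder m n) = {..<m} \<times> {..<n}"
  by (simp add: cartesian_product_def path_graph_def cycle_graph_def)

lemma simple_graph_cylinder: "3 \<le> n \<Longrightarrow> simple_graph (cylinder m n)"
  by (intro simple_graph_cartesian_product simple_graph_path_graph simple_graph_cycle_graph)

text \<open>
  By parity, an inner row is paired with an inner row; this is what makes \<open>rung_odd\<close> an involution.
\<close>

lemma odd_partner_outer:
  assumes "even m" "i < m" "\<not> outer m i"
  shows "\<not> outer m (odd_partner m i)"
  using assms by (auto simp: odd_partner_def elim!: oddE evenE) presburger+

lemma partner_map_cylinder: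
  assumes "even m" "even n" "2 \<le> n"
  shows "partner_map (cylinder m n) row_even" "partner_map (cylinder m n) (row_odd n)"
    "partner_map (cylinder m n) rung_even" "partner_map (cylinder m n) (rung_odd m)"
proof -
  note partner = even_partner[OF assms(1)] even_partner[OF assms(2)]
    odd_partner[OF assms(1)] odd_partner[OF assms(2)] odd_partner_outer[OF assms(1)]
  note edge = cylinder_edge_iff cycle_edge_iff[OF assms(2,3)] path_edge_iff[OF assms(1)]
  show "partner_map (cylinder m n) row_even"
    by (auto simp: partner_map_def verts_cylinder row_even_def edge partner)
  show "partner_map (cylinder m n) (row_odd n)"
    by (auto simp: partner_map_def verts_cylinder row_odd_def edge partner)
  show "partner_map (cylinder m n) rung_even"
    by (auto simp: partner_map_def verts_cylinder rung_even_def edge partner)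
  show "partner_map (cylinder m n) (rung_odd m)"
    unfolding partner_map_def
  proof
    fix v assume "v \<in> verts (cylinder m n)"
    then obtain i j where v: "v = (i, j)" "i < m" "j < n" by (auto simp: verts_cylinder)
    show "rung_odd m v \<in> verts (cylinder m n) \<and> rung_odd m (rung_odd m v) = v
        \<and> {v, rung_odd m v} \<in> edges (cylinder m n)"
    proof (cases "outer m i")
      case True
      with v show ?thesis
        by (simp add: verts_cylinder rung_odd_def edge partner)
    next
      case False
      with v partner(13)[of i] show ?thesis
        by (simp add: verts_cylinder rung_odd_def edge partner)
    qed
  qed
qed

text \<open>
  The four matchings cover all edges, so the edges at a vertex are bounded by its four partners; and
  every edge joins the two colour classes.
\<close>

lemma cylinder_edge_at:
  assumes "even m" "even n" "2 \<le> n" "e \<in> edges (cylinder m n)" "v \<in> e"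
  shows "e \<in> {{v, row_even v}, {v, row_odd n v}, {v, rung_even v}, {v, rung_odd m v}}"
    and "\<exists>w. e = {v, w} \<and> even (fst w + snd w) \<noteq> even (fst v + snd v)"
proof -
  obtain i j k l where e: "e = {(i, j), (k, l)}" "v = (i, j)"
    using assms(4,5) unfolding cartesian_product_def
    by (auto simp: doubleton_eq_iff)
  then have "i < m" "j < n" "k < m" "l < n" and
    "i = k \<and> {j, l} \<in> edges (cycle_graph n) \<or> {i, k} \<in> edges (path_graph m) \<and> j = l"
    using assms(4) by (simp_all add: cylinder_edge_iff)
  then consider "i = k" "l = even_partner j" | "i = k" "l = odd_partner n j"
    | "j = l" "k = even_partner i" | "j = l" "k = odd_partner m i" "\<not> outer m i"
    by (auto simp: cycle_edge_iff[OF assms(2,3)] path_edge_iff[OF assms(1)])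
  note cases = this
  show "e \<in> {{v, row_even v}, {v, row_odd n v}, {v, rung_even v}, {v, rung_odd m v}}"
    using cases by cases (simp_all add: e row_even_def row_odd_def rung_even_def rung_odd_def)
  have "even (k + l) \<noteq> even (i + j)"
    using cases \<open>i < m\<close> \<open>j < n\<close> even_partner(3)[OF assms(1), of i] even_partner(3)[OF assms(2), of j]
      odd_partner(3)[OF assms(1), of i] odd_partner(3)[OF assms(2), of j]
    by cases auto
  with e show "\<exists>w. e = {v, w} \<and> even (fst w + snd w) \<noteq> even (fst v + snd v)" by auto
qed

lemma cylinder_matchings_disjoint:
  assumes "even m" "even n" "4 \<le> n"
  defines "E \<equiv> partner_edges (cylinder m n)"
  shows "E row_even \<inter> E (row_odd n) = {}" "E row_even \<inter> E rung_even = {}"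
    "E (row_odd n) \<inter> E rung_even = {}" "E (rung_odd m) \<inter> E (row_odd n) = {}"
    "E (rung_odd m) \<inter> E rung_even = {}"
proof -
  have n: "2 \<le> n" "3 \<le> n" "2 < n" using assms(3) by auto
  note disj = partner_edges_disjoint[OF simple_graph_cylinder[OF n(2)]]
  note pm = partner_map_cylinder[OF assms(1,2) n(1)]
  note neq = even_partner_neq_odd_partner[OF n(3)]
  have self: "even_partner i \<noteq> i" for i
    by (auto simp: even_partner_def elim!: oddE)
  have self': "odd_partner n j \<noteq> j" if "j < n" for j
    using odd_partner(3)[OF assms(2) that] by metis
  have self'': "odd_partner m i \<noteq> i" if "i < m" for i
    using odd_partner(3)[OF assms(1) that] by metis
  have inner: "even_partner i \<noteq> odd_partner m i" if "i < m" "\<not> outer m i" for i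
    using that even_partner_neq_odd_partner[of m i] by linarith
  show "E row_even \<inter> E (row_odd n) = {}"
    unfolding E_def by (rule disj[OF pm(1,2)]) (use neq in \<open>auto simp: verts_cylinder row_even_def row_odd_def\<close>)
  show "E row_even \<inter> E rung_even = {}"
    unfolding E_def by (rule disj[OF pm(1,3)]) (use self in \<open>auto simp: verts_cylinder row_even_def rung_even_def\<close>)
  show "E (row_odd n) \<inter> E rung_even = {}"
    unfolding E_def by (rule disj[OF pm(2,3)]) (use self self' in \<open>auto simp: verts_cylinder row_odd_def rung_even_def\<close>)
  show "E (rung_odd m) \<inter> E (row_odd n) = {}"
    unfolding E_def
    by (rule disj[OF pm(4,2)]) (use neq self' self'' in \<open>auto simp: verts_cylinder rung_odd_def row_odd_def split: if_splits\<close>)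
  show "E (rung_odd m) \<inter> E rung_even = {}"
    unfolding E_def
    by (rule disj[OF pm(4,3)])
      (use inner self in \<open>auto simp: verts_cylinder rung_odd_def rung_even_def eq_commute split: if_splits\<close>)
qed

lemma card_outer_vertices:
  assumes "2 \<le> m"
  shows "card {v \<in> verts (cylinder m n). outer m (fst v)} = 2 * n"
proof -
  have "{v \<in> verts (cylinder m n). outer m (fst v)} = {0, m - 1} \<times> {..<n}"
    using assms by (auto simp: verts_cylinder)
  with assms show ?thesis by simp
qed

lemma card_matchings_overlap:
  assumes "even m" "even n" "2 \<le> m" "4 \<le> n"
  shows "card (partner_edges (cylinder m n) row_even \<inter> partner_edges (cylinder m n) (rung_odd m)) = n"
proof -
  have n: "2 \<le> n" "3 \<le> n" using assms(4) by auto
  have self: "even_partner i \<noteq> i" for i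
    by (auto simp: even_partner_def elim!: oddE)
  have "{v \<in> verts (cylinder m n). row_even v = rung_odd m v} = {v \<in> verts (cylinder m n). outer m (fst v)}"
    using self by (auto simp: row_even_def rung_odd_def split: if_splits)
  then show ?thesis
    using card_partner_edges_Int[OF simple_graph_cylinder[OF n(2)], of m row_even "rung_odd m"]
      partner_map_cylinder[OF assms(1,2) n(1)] card_outer_vertices[OF assms(3), of n] by simp
qed

text \<open>
  Moving along \<open>row_even\<close> changes the colour and keeps the row, so both the whole vertex set and the
  outer rows split evenly between the colours.
\<close>

lemma card_even_vertices:
  assumes "even n" "2 \<le> m"
  shows "2 * card {v \<in> verts (cylinder m n). even (fst v + snd v)} = m * n"
    and "card {v \<in> verts (cylinder m n). outer m (fst v) \<and> even (fst v + snd v)} = n"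
proof -
  have flip: "row_even v \<in> verts (cylinder m n) \<and> row_even (row_even v) = v \<and> fst (row_even v) = fst v \<and>
      (even (fst (row_even v) + snd (row_even v)) \<longleftrightarrow> \<not> even (fst v + snd v))"
    if "v \<in> verts (cylinder m n)" for v
    using that even_partner[OF assms(1)] by (auto simp: verts_cylinder row_even_def)
  have fin: "finite (verts (cylinder m n))" by (simp add: verts_cylinder)
  show "2 * card {v \<in> verts (cylinder m n). even (fst v + snd v)} = m * n"
  proof -
    have "2 * card {v \<in> verts (cylinder m n). even (fst v + snd v)} = card (verts (cylinder m n))"
      by (rule card_half_involution[where f = row_even]) (use fin flip in blast)+
    then show ?thesis by (simp add: verts_cylinder)
  qed
  have "2 * card {v \<in> {v \<in> verts (cylinder m n). outer m (fst v)}. even (fst v + snd v)} = 2 * n"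
    unfolding card_outer_vertices[OF assms(2), of n, symmetric]
    by (rule card_half_involution[where f = row_even])
      (use fin in simp, use flip in \<open>metis (no_types, lifting) mem_Collect_eq\<close>)
  then show "card {v \<in> verts (cylinder m n). outer m (fst v) \<and> even (fst v + snd v)} = n"
    by (simp add: conj_assoc)
qed

text \<open>
  In an outer row \<open>row_even\<close> and \<open>rung_odd\<close> give the same edge, so only three edges remain.
\<close>

lemma card_edges_at_le:
  assumes "even m" "even n" "2 \<le> n"
  shows "card {e \<in> edges (cylinder m n). v \<in> e} \<le> (if outer m (fst v) then 3 else 4)"
proof (cases "outer m (fst v)")
  case True
  then have "rung_odd m v = row_even v"
    by (auto simp: rung_odd_def row_even_def split: prod.splits)
  then have "{e \<in> edges (cylinder m n). v \<in> e} \<subseteq> set [{v, row_even v}, {v, row_odd n v}, {v, rung_even v}]"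
    using cylinder_edge_at(1)[OF assms, of _ v] by auto
  from card_mono[OF finite_set this] have "card {e \<in> edges (cylinder m n). v \<in> e} \<le> 3"
    by (rule order_trans[OF _ order_trans[OF card_length]]) simp
  with True show ?thesis by simp
next
  case False
  have "{e \<in> edges (cylinder m n). v \<in> e}
      \<subseteq> set [{v, row_even v}, {v, row_odd n v}, {v, rung_even v}, {v, rung_odd m v}]"
    using cylinder_edge_at(1)[OF assms, of _ v] by auto
  from card_mono[OF finite_set this] have "card {e \<in> edges (cylinder m n). v \<in> e} \<le> 4"
    by (rule order_trans[OF _ order_trans[OF card_length]]) simp
  with False show ?thesis by simp
qed

lemma ex_subset_preferring:
  assumes "finite A" "B \<subseteq> A" "d \<le> card A"
  shows "\<exists>W\<subseteq>A. card W = d \<and> card (W \<inter> B) = min d (card B)"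
proof (cases "d \<le> card B")
  case True
  then obtain W where W: "W \<subseteq> B" "card W = d" by (rule obtain_subset_with_card_n)
  then have "W \<inter> B = W" by blast
  with W True assms(2) show ?thesis by (intro exI[of _ W]) auto
next
  case False
  then have "card B \<le> d" by simp
  then obtain W where W: "B \<subseteq> W" "W \<subseteq> A" "card W = d"
    using exists_subset_between[of B d A] assms by blast
  then have "W \<inter> B = B" by blast
  with W False show ?thesis by (intro exI[of _ W]) auto
qed

lemma ex_even_vertices:
  assumes "even n" "2 \<le> m" "d \<le> m * n div 2"
  shows "\<exists>W\<subseteq>{v \<in> verts (cylinder m n). even (fst v + snd v)}.
    card W = d \<and> card {v \<in> W. outer m (fst v)} = min d n"
proof -
  define A where "A = {v \<in> verts (cylinder m n). even (fst v + snd v)}"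
  define B where "B = {v \<in> verts (cylinder m n). outer m (fst v) \<and> even (fst v + snd v)}"
  have "finite A" "B \<subseteq> A" by (auto simp: A_def B_def verts_cylinder)
  moreover have A: "2 * card A = m * n" and B: "card B = n"
    unfolding A_def B_def using card_even_vertices[OF assms(1,2)] by blast+
  moreover have "d \<le> card A" using A assms(3) by linarith
  ultimately obtain W where W: "W \<subseteq> A" "card W = d" "card (W \<inter> B) = min d n"
    using ex_subset_preferring[of A B d] by auto
  moreover have "W \<inter> B = {v \<in> W. outer m (fst v)}"
    using W(1) unfolding A_def B_def by blast
  ultimately show ?thesis unfolding A_def by auto
qed

text \<open>
  The term \<open>min d n\<close> is the number of chosen outer vertices, each of which saves one edge against
  degree 4.
\<close>

lemma transversal_number_cylinder_le:
  assumes "even m" "even n" "2 \<le> m" "4 \<le> n" "1 \<le> d" "d \<le> m * n div 2"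
  shows "\<tau> d (cylinder m n) + min d n \<le> 4 * d"
proof -
  let ?G = "cylinder m n"
  have n: "2 \<le> n" "3 \<le> n" using assms(4) by auto
  note G = simple_graph_cylinder[OF n(2), of m]
  have perfect: "2 * \<nu> ?G = card (verts ?G)"
    using maximum_matching_partner_edges(2)[OF G] partner_map_cylinder[OF assms(1,2) n(1)] by blast
  then have \<nu>: "\<nu> ?G = m * n div 2" by (simp add: verts_cylinder)
  obtain W where W: "W \<subseteq> {v \<in> verts ?G. even (fst v + snd v)}" "card W = d"
    "card {v \<in> W. outer m (fst v)} = min d n"
    using ex_even_vertices[OF assms(2,3,6)] by blast
  have finW: "finite W" using W(2) assms(5) by (metis card.infinite not_one_le_zero)
  let ?T = "{e \<in> edges ?G. e \<inter> W \<noteq> {}}"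
  have indep: "u = v" if "e \<in> edges ?G" "u \<in> e" "v \<in> e" "u \<in> W" "v \<in> W" for e u v
    using cylinder_edge_at(2)[OF assms(1,2) n(1) that(1,2)] that W(1) by auto
  have "W \<subseteq> verts ?G" using W(1) by auto
  then have "transversal_set d ?G ?T"
    using transversal_set_star[OF G perfect _ _ _ indep, of W] W(2) assms(5,6) \<nu> by simp
  then have "\<tau> d ?G \<le> card ?T"
    using transversal_number_attained(2)[OF G] assms(5,6) \<nu> by simp
  also have "card ?T \<le> (\<Sum>v\<in>W. card {e \<in> edges ?G. v \<in> e})"
  proof -
    have "?T = (\<Union>v\<in>W. {e \<in> edges ?G. v \<in> e})" by auto
    then show ?thesis using card_UN_le[OF finW] by metis
  qed
  also have "\<dots> \<le> (\<Sum>v\<in>W. if outer m (fst v) then 3 else 4)"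
    by (intro sum_mono card_edges_at_le assms n)
  finally have "\<tau> d ?G + card {v \<in> W. outer m (fst v)}
      \<le> (\<Sum>v\<in>W. if outer m (fst v) then 3 else 4) + (\<Sum>v\<in>W. if outer m (fst v) then 1 else 0)"
    using finW by (simp add: sum.If_cases Int_def)
  also have "\<dots> = (\<Sum>v\<in>W. 4)"
    unfolding sum.distrib[symmetric] by (rule sum.cong) auto
  finally show ?thesis using W by simp
qed

lemma transversal_number_cylinder_ge:
  assumes "even m" "even n" "2 \<le> m" "4 \<le> n" "1 \<le> d" "d \<le> m * n div 2"
  shows "3 * d \<le> \<tau> d (cylinder m n)" "4 * d \<le> \<tau> d (cylinder m n) + n"
proof -
  let ?G = "cylinder m n" and ?E = "partner_edges (cylinder m n)"
  have n: "2 \<le> n" "3 \<le> n" using assms(4) by auto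
  note G = simple_graph_cylinder[OF n(2), of m]
  note pm = partner_map_cylinder[OF assms(1,2) n(1)]
  note max = pm[THEN maximum_matching_partner_edges(1)[OF G]]
  note disj = cylinder_matchings_disjoint[OF assms(1,2,4)]
  have "\<nu> ?G = m * n div 2"
    using maximum_matching_partner_edges(2)[OF G pm(1)] by (simp add: verts_cylinder)
  then obtain T where T: "transversal_set d ?G T" "card T = \<tau> d ?G"
    using transversal_number_attained(1)[OF G assms(5)] assms(6) by auto
  show "3 * d \<le> \<tau> d ?G"
    using transversal_card_ge_disjoint_matchings[OF G T(1) max(1,2,3) disj(1,2,3)] T(2) by simp
  show "4 * d \<le> \<tau> d ?G + n"
    using transversal_card_ge_overlapping_matchings[OF G T(1) max(1,2,3,4) disj]
      card_matchings_overlap[OF assms(1-4)] T(2) by simp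
qed

section \<open>The transversal numbers of the cylinder\<close>

theorem theorem3p3:
  fixes m n d :: nat
  assumes "even m" and "even n"
  shows "(m \<ge> 2 \<and> n \<ge> 4 \<and> 1 \<le> d \<and> d \<le> n \<longrightarrow>
            \<tau> d (path_graph m \<box> cycle_graph n) = 3 * d) \<and>
         (m \<ge> 4 \<and> n \<ge> 4 \<and> n + 1 \<le> d \<and> d \<le> m * n div 2 \<longrightarrow>
            int (\<tau> d (path_graph m \<box> cycle_graph n)) = 4 * int d - int n)"
proof (intro conjI impI; elim conjE)
  assume *: "m \<ge> 2" "n \<ge> 4" "1 \<le> d" "d \<le> n"
  have "n \<le> m * n div 2" using mult_le_mono1[OF *(1), of n] by linarith
  with *(4) have "d \<le> m * n div 2" by linarith
  with * show "\<tau> d (cylinder m n) = 3 * d"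
    using transversal_number_cylinder_le[OF assms, of d] transversal_number_cylinder_ge(1)[OF assms, of d]
    by simp
next
  assume *: "m \<ge> 4" "n \<ge> 4" "n + 1 \<le> d" "d \<le> m * n div 2"
  then have "4 * d = \<tau> d (cylinder m n) + n"
    using transversal_number_cylinder_le[OF assms, of d] transversal_number_cylinder_ge(2)[OF assms, of d]
    by simp
  then show "int (\<tau> d (cylinder m n)) = 4 * int d - int n" by linarith
qed

end
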